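(* Let $G_\bullet$ be a torsion-free vertex-stable $\mathrm{FI}$-graph with edge-stable degree $\leq d_E$. Then for any $n \geq d_E$ and any injection $f:[n] \hookrightarrow [n+1]$, the image of the transition map $G(f):G_n\to G_{n+1}$ is an induced subgraph of $G_{n+1}$.
   Context: Graphs are finite and simple (no multi-edges, no self-loops), possibly disconnected. A homomorphism of graphs $\phi:G\to G'$ is a map $V(G)\to V(G')$ such that $\{x,y\}\in E(G)$ implies $\{\phi(x),\phi(y)\}\in E(G')$. Its image is the subgraph formed by the images of the vertices and of the edges. A subgraph $G'\subseteq G$ is induced if for all $x,y\in V(G')$, $\{x,y\}\in E(G)$ implies $\{x,y\}\in E(G')$. Let $[n]=\{1,\dots,n\}$, and let $\mathrm{FI}$ be the category with objects $[n]$, $n\ge 0$, and morphisms all injections. An $\mathrm{FI}$-graph $G_\bullet$ is a functor from $\mathrm{FI}$ to the category of graphs and graph homomorphisms; $G_n$ is its value on $[n]$, and the maps $G(f)$ induced by injections $f$ are the transition maps. $G_\bullet$ is: vertex-stable if there is $d$ such that for all $n\ge d$ and every $v\in V(G_{n+1})$ there exist $w\in V(G_n)$ and an injection $f:[n]\hookrightarrow[n+1]$ with $G(f)(w)=v$; edge-stable with edge-stable degree $\le k$ if for all $n\ge k$ and every $\{x,y\}\in E(G_n)$ there are an edge $\{v,w\}\in E(G_k)$ and an injection $f:[k]\hookrightarrow[n]$ with $G(f)(v)=x$ and $G(f)(w)=y$; torsion-free if $G(f)$ is injective for every injection $f:[n]\hookrightarrow[m]$. *)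

theory Defs
  imports "HOL-Library.FuncSet" "Graph_Theory.Digraph_Component"
begin

text \<open>
  A finite simple graph is a \<^locale>\<open>pair_graph\<close>: a finite, loop-free, symmetric set of arcs on a
  finite vertex set. An edge \<open>{x, y}\<close> is the pair of arcs \<open>(x, y)\<close> and \<open>(y, x)\<close>.
\<close>

definition graph_hom :: "'a pair_pre_digraph \<Rightarrow> 'b pair_pre_digraph \<Rightarrow> ('a \<Rightarrow> 'b) \<Rightarrow> bool" where
  "graph_hom G H \<phi> \<longleftrightarrow>
     \<phi> \<in> pverts G \<rightarrow> pverts H \<and> (\<forall>x y. (x, y) \<in> parcs G \<longrightarrow> (\<phi> x, \<phi> y) \<in> parcs H)"

definition hom_image :: "('a \<Rightarrow> 'b) \<Rightarrow> 'a pair_pre_digraph \<Rightarrow> 'b pair_pre_digraph" where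
  "hom_image \<phi> G = \<lparr>pverts = \<phi> ` pverts G, parcs = map_prod \<phi> \<phi> ` parcs G\<rparr>"

text \<open>
  The injections \<open>[m] \<rightarrow> [n]\<close>, as extensional functions, so that each injection is represented
  exactly once.
\<close>

definition FI_hom :: "nat \<Rightarrow> nat \<Rightarrow> (nat \<Rightarrow> nat) set" where
  "FI_hom m n = {f \<in> {1..m} \<rightarrow>\<^sub>E {1..n}. inj_on f {1..m}}"

text \<open>
  \<open>T m n f\<close> is the transition map \<open>G(f)\<close> of an injection \<open>f : [m] \<rightarrow> [n]\<close>; only its values on the
  vertices of \<open>G m\<close> are meaningful. The vertex sets of the graphs \<open>G n\<close> share a type but are not
  related to each other in any way.
\<close>

locale FI_graph =
  fixes G :: "nat \<Rightarrow> 'v pair_pre_digraph"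
    and T :: "nat \<Rightarrow> nat \<Rightarrow> (nat \<Rightarrow> nat) \<Rightarrow> 'v \<Rightarrow> 'v"
  assumes graph: "pair_graph (G n)"
    and transition_hom: "f \<in> FI_hom m n \<Longrightarrow> graph_hom (G m) (G n) (T m n f)"
    and transition_id: "x \<in> pverts (G n) \<Longrightarrow> T n n (\<lambda>i\<in>{1..n}. i) x = x"
    and transition_comp:
      "\<lbrakk>f \<in> FI_hom l m; g \<in> FI_hom m n; x \<in> pverts (G l)\<rbrakk>
        \<Longrightarrow> T l n (compose {1..l} g f) x = T m n g (T l m f x)"
begin

definition vertex_stable :: bool where
  "vertex_stable \<longleftrightarrow>
     (\<exists>d. \<forall>n\<ge>d. \<forall>v\<in>pverts (G (n + 1)).
        \<exists>w\<in>pverts (G n). \<exists>f\<in>FI_hom n (n + 1). T n (n + 1) f w = v)"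

definition edge_stable_degree_le :: "nat \<Rightarrow> bool" where
  "edge_stable_degree_le k \<longleftrightarrow>
     (\<forall>n\<ge>k. \<forall>x y. (x, y) \<in> parcs (G n) \<longrightarrow>
        (\<exists>v w. (v, w) \<in> parcs (G k) \<and>
          (\<exists>f\<in>FI_hom k n. T k n f v = x \<and> T k n f w = y)))"

definition torsion_free :: bool where
  "torsion_free \<longleftrightarrow> (\<forall>m n. \<forall>f\<in>FI_hom m n. inj_on (T m n f) (pverts (G m)))"

end

end

theory Submission
  imports Defs "HOL-Combinatorics.Transposition"
begin

text \<open>
  Let \<open>N = n + 1\<close>, let \<open>b\<close> be the point missed by \<open>f\<close>, and suppose an edge \<open>{x, y}\<close> of \<open>G N\<close> has both
  ends in the image of \<open>G(f)\<close>. Edge stability writes it as the image of an edge under some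
  \<open>g : [d\<^sub>E] \<rightarrow> [N]\<close>, which misses some \<open>c\<close> because \<open>d\<^sub>E \<le> n\<close>. A vertex that lies both in the image of
  a map missing \<open>b\<close> and of a map missing \<open>c\<close> is fixed by the transposition \<open>(b c)\<close>: after adding a
  new point \<open>*\<close>, it is fixed by \<open>(b *)\<close> and by \<open>(c *)\<close>, hence by \<open>(b c)\<close>, and injectivity of the
  inclusion's transition map brings this back to \<open>N\<close>. So \<open>g\<close> may be replaced by \<open>(b c) \<circ> g\<close>, which
  misses \<open>b\<close> and therefore factors through \<open>f\<close>.
\<close>

lemma FI_homI:
  assumes "\<And>i. i \<in> {1..m} \<Longrightarrow> f i \<in> {1..n}" and "inj_on f {1..m}"
  shows "restrict f {1..m} \<in> FI_hom m n"
  using assms by (auto simp: FI_hom_def)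

lemma FI_hom_mem: "f \<in> FI_hom m n \<Longrightarrow> i \<in> {1..m} \<Longrightarrow> f i \<in> {1..n}"
  by (auto simp: FI_hom_def)

lemma FI_hom_inj: "f \<in> FI_hom m n \<Longrightarrow> inj_on f {1..m}"
  by (simp add: FI_hom_def)

lemma FI_hom_transpose:
  assumes "m \<le> n" and "b \<in> {1..n}" and "c \<in> {1..n}"
  shows "restrict (transpose b c) {1..m} \<in> FI_hom m n"
proof (rule FI_homI)
  show "transpose b c i \<in> {1..n}" if "i \<in> {1..m}" for i
    using assms that by (auto simp: transpose_def)
qed simp

lemma FI_hom_compose:
  assumes "f \<in> FI_hom l m" and "g \<in> FI_hom m n"
  shows "compose {1..l} g f \<in> FI_hom l n"
proof -
  have "f ` {1..l} \<subseteq> {1..m}"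
    using assms(1) FI_hom_mem by blast
  then have "inj_on (g \<circ> f) {1..l}"
    using assms by (meson FI_hom_inj comp_inj_on inj_on_subset)
  then show ?thesis
    using FI_homI[of l "g \<circ> f" n] assms FI_hom_mem unfolding compose_def comp_def by blast
qed

lemma FI_hom_misses_point:
  assumes "f \<in> FI_hom m n" and "m < n"
  obtains b where "b \<in> {1..n}" and "b \<notin> f ` {1..m}"
proof -
  have "card (f ` {1..m}) < card {1..n}"
    using assms(2) card_image[OF FI_hom_inj[OF assms(1)]] by simp
  then have "\<not> {1..n} \<subseteq> f ` {1..m}"
    using card_mono by (meson finite_atLeastAtMost finite_imageI not_le)
  then show ?thesis using that by blast
qed

text \<open>The factor is \<open>g\<close> followed by the inverse of \<open>f\<close> on its
  image.\<close>

lemma FI_hom_factor: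
  assumes f: "f \<in> FI_hom m n" and g: "g \<in> FI_hom l n" and sub: "g ` {1..l} \<subseteq> f ` {1..m}"
  obtains h where "h \<in> FI_hom l m" and "g = compose {1..l} f h"
proof
  let ?h = "restrict (inv_into {1..m} f \<circ> g) {1..l}"
  show "?h \<in> FI_hom l m"
  proof (rule FI_homI)
    show "(inv_into {1..m} f \<circ> g) i \<in> {1..m}" if "i \<in> {1..l}" for i
      using sub that by (metis comp_apply image_subset_iff inv_into_into)
    show "inj_on (inv_into {1..m} f \<circ> g) {1..l}"
      using FI_hom_inj[OF g] inj_on_inv_into[OF sub] by (rule comp_inj_on)
  qed
  \<comment> \<open>Equality of functions also concerns arguments outside \<open>{1..l}\<close>,
    where both sides must be \<open>undefined\<close>.\<close>
  have "g \<in> extensional {1..l}"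
    using g by (simp add: FI_hom_def PiE_def)
  then show "g = compose {1..l} f ?h"
    using sub by (intro ext) (auto simp: compose_def extensional_def f_inv_into_f image_subset_iff)
qed

text \<open>Both sides have \<open>n\<close> elements. Hence a map that avoids \<open>b\<close>
  already lands in the image of \<open>f\<close>.\<close>

lemma FI_hom_Suc_image:
  assumes "f \<in> FI_hom n (n + 1)" and "b \<in> {1..n + 1}" and "b \<notin> f ` {1..n}"
  shows "f ` {1..n} = {1..n + 1} - {b}"
proof (rule card_subset_eq)
  show "f ` {1..n} \<subseteq> {1..n + 1} - {b}"
    using assms FI_hom_mem by blast
  show "card (f ` {1..n}) = card ({1..n + 1} - {b})"
    using assms(2) card_image[OF FI_hom_inj[OF assms(1)]] by simp
qed simp

context FI_graph
begin

lemma transition_mem: "f \<in> FI_hom m n \<Longrightarrow> x \<in> pverts (G m) \<Longrightarrow> T m n f x \<in> pverts (G n)"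
  using transition_hom by (fastforce simp: graph_hom_def)

lemma transition_arc:
  "f \<in> FI_hom m n \<Longrightarrow> (x, y) \<in> parcs (G m) \<Longrightarrow> (T m n f x, T m n f y) \<in> parcs (G n)"
  using transition_hom by (fastforce simp: graph_hom_def)

lemma arc_verts:
  assumes "(x, y) \<in> parcs (G n)"
  shows "x \<in> pverts (G n)" and "y \<in> pverts (G n)"
proof -
  interpret pair_graph "G n" by (rule graph)
  show "x \<in> pverts (G n)" "y \<in> pverts (G n)"
    using assms wellformed' by auto
qed

text \<open>By functoriality, the value at a vertex coming from \<open>f\<close> depends only on the
  composite with \<open>f\<close>.\<close>

lemma transition_cong_on_image:
  assumes "f \<in> FI_hom l m" "p \<in> FI_hom m n" "q \<in> FI_hom m n"
    and "\<And>i. i \<in> f ` {1..l} \<Longrightarrow> p i = q i"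
    and "x \<in> T l m f ` pverts (G l)"
  shows "T m n p x = T m n q x"
proof -
  have "compose {1..l} p f = compose {1..l} q f"
    using assms(4) by (auto simp: compose_def)
  moreover obtain z where "z \<in> pverts (G l)" "x = T l m f z"
    using assms(5) by blast
  ultimately show ?thesis
    using transition_comp[OF assms(1,2)] transition_comp[OF assms(1,3)] by metis
qed

lemma transpose_fixes_vertex:
  assumes tf: "torsion_free"
    and f: "f \<in> FI_hom l N" and b: "b \<in> {1..N}" "b \<notin> f ` {1..l}" and xf: "x \<in> T l N f ` pverts (G l)"
    and g: "g \<in> FI_hom m N" and c: "c \<in> {1..N}" "c \<notin> g ` {1..m}" and xg: "x \<in> T m N g ` pverts (G m)"
  shows "T N N (restrict (transpose b c) {1..N}) x = x"
proof -
  \<comment> \<open>The extra point is \<open>N + 1\<close>: \<open>p a\<close> moves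
    \<open>a\<close> to it and fixes the rest of \<open>{1..N}\<close>, while \<open>s\<close> swaps
    it with \<open>b\<close>.\<close>
  define \<iota> where "\<iota> = (\<lambda>i\<in>{1..N}. i)"
  define p where "p a = restrict (transpose a (N + 1)) {1..N}" for a
  define s where "s = restrict (transpose b (N + 1)) {1..N + 1}"
  define t where "t = restrict (transpose b c) {1..N}"
  have \<iota>: "\<iota> \<in> FI_hom N (N + 1)"
    unfolding \<iota>_def by (rule FI_homI) auto
  have p: "p a \<in> FI_hom N (N + 1)" if "a \<in> {1..N}" for a
    unfolding p_def using that by (intro FI_hom_transpose) auto
  have s: "s \<in> FI_hom (N + 1) (N + 1)"
    unfolding s_def using b by (intro FI_hom_transpose) auto
  have t: "t \<in> FI_hom N N"
    unfolding t_def using b c by (intro FI_hom_transpose) auto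
  have x: "x \<in> pverts (G N)"
    using xf f transition_mem by blast
  have fN: "i \<in> {1..N} \<and> i \<noteq> b" if "i \<in> f ` {1..l}" for i
    using that b f FI_hom_mem by blast
  have gN: "i \<in> {1..N} \<and> i \<noteq> c" if "i \<in> g ` {1..m}" for i
    using that c g FI_hom_mem by blast
  have \<iota>b: "T N (N + 1) \<iota> x = T N (N + 1) (p b) x"
    using f \<iota> p[OF b(1)] _ xf
  proof (rule transition_cong_on_image)
    fix i assume "i \<in> f ` {1..l}"
    then show "\<iota> i = p b i"
      using fN[of i] by (auto simp: \<iota>_def p_def transpose_def)
  qed
  have \<iota>c: "T N (N + 1) \<iota> x = T N (N + 1) (p c) x"
    using g \<iota> p[OF c(1)] _ xg
  proof (rule transition_cong_on_image)
    fix i assume "i \<in> g ` {1..m}"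
    then show "\<iota> i = p c i"
      using gN[of i] by (auto simp: \<iota>_def p_def transpose_def)
  qed
  have sb: "compose {1..N} s (p b) = \<iota>"
  proof
    fix i
    have "transpose b (N + 1) i \<in> {1..N + 1}" if "i \<in> {1..N}"
      using b that by (auto simp: transpose_def)
    then show "compose {1..N} s (p b) i = \<iota> i"
      by (simp add: compose_def s_def p_def \<iota>_def)
  qed
  have "T N (N + 1) \<iota> (T N N t x) = T N (N + 1) (compose {1..N} \<iota> t) x"
    using transition_comp[OF t \<iota> x] by simp
  \<comment> \<open>Both composites send \<open>c\<close> to \<open>b\<close> and fix every other
    point except possibly \<open>b\<close>, which \<open>f\<close> misses.\<close>
  also have "\<dots> = T N (N + 1) (compose {1..N} s (p c)) x"
    using f FI_hom_compose[OF t \<iota>] FI_hom_compose[OF p[OF c(1)] s] _ xf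
  proof (rule transition_cong_on_image)
    fix i assume "i \<in> f ` {1..l}"
    then show "compose {1..N} \<iota> t i = compose {1..N} s (p c) i"
      using fN[of i] b c by (auto simp: compose_def s_def p_def \<iota>_def t_def transpose_def)
  qed
  \<comment> \<open>Since \<open>p b\<close> and \<open>p c\<close> both act on \<open>x\<close> as
    \<open>\<iota>\<close> does, one may replace the other; then \<open>s\<close> undoes
    \<open>p b\<close>.\<close>
  also have "\<dots> = T (N + 1) (N + 1) s (T N (N + 1) (p b) x)"
    using transition_comp[OF p[OF c(1)] s x] \<iota>b \<iota>c by simp
  also have "\<dots> = T N (N + 1) \<iota> x"
    using transition_comp[OF p[OF b(1)] s x] sb by simp
  finally have "T N (N + 1) \<iota> (T N N t x) = T N (N + 1) \<iota> x" .
  moreover have "inj_on (T N (N + 1) \<iota>) (pverts (G N))"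
    using tf \<iota> by (auto simp: torsion_free_def)
  ultimately show ?thesis
    using x transition_mem[OF t x] by (auto simp: t_def dest: inj_onD)
qed

lemma transition_reflects_arc:
  assumes tf: "torsion_free" and es: "edge_stable_degree_le k" and "k \<le> n"
    and f: "f \<in> FI_hom n (n + 1)" and x: "x \<in> pverts (G n)" and y: "y \<in> pverts (G n)"
    and arc: "(T n (n + 1) f x, T n (n + 1) f y) \<in> parcs (G (n + 1))"
  shows "(x, y) \<in> parcs (G n)"
proof -
  define N where "N = n + 1"
  have f': "f \<in> FI_hom n N" using f by (simp add: N_def)
  obtain b where b: "b \<in> {1..N}" "b \<notin> f ` {1..n}"
    using FI_hom_misses_point[OF f'] by (auto simp: N_def)
  have "k \<le> N" using \<open>k \<le> n\<close> by (simp add: N_def)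
  then obtain v w g where vw: "(v, w) \<in> parcs (G k)" and g: "g \<in> FI_hom k N"
    and gv: "T k N g v = T n N f x" and gw: "T k N g w = T n N f y"
    using es arc unfolding edge_stable_degree_le_def N_def by blast
  obtain c where c: "c \<in> {1..N}" "c \<notin> g ` {1..k}"
    using FI_hom_misses_point[OF g] \<open>k \<le> n\<close> by (auto simp: N_def)
  define t where "t = restrict (transpose b c) {1..N}"
  have t: "t \<in> FI_hom N N"
    unfolding t_def using b c by (intro FI_hom_transpose) auto
  \<comment> \<open>The transposition takes the value \<open>b\<close> only at \<open>c\<close>,
    which \<open>g\<close> misses.\<close>
  have "b \<notin> compose {1..k} t g ` {1..k}"
    using c g FI_hom_mem[OF g] by (auto simp: compose_def t_def transpose_def split: if_splits)
  then have "compose {1..k} t g ` {1..k} \<subseteq> f ` {1..n}"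
    using FI_hom_Suc_image[OF f] b FI_hom_mem[OF FI_hom_compose[OF g t]] unfolding N_def by blast
  then obtain h where h: "h \<in> FI_hom k n" and th: "compose {1..k} t g = compose {1..k} f h"
    using FI_hom_factor[OF f' FI_hom_compose[OF g t]] by blast
  \<comment> \<open>The vertex \<open>T n N f z\<close> lies in the images of both \<open>f\<close>
    and \<open>g\<close>, so \<open>t\<close> fixes it; torsion-freeness then cancels
    \<open>f\<close>. Applied to \<open>v\<close> and \<open>w\<close>, this shows that
    \<open>h\<close> carries the edge to \<open>x\<close> and \<open>y\<close>.\<close>
  have lift: "T k n h u = z"
    if u: "u \<in> pverts (G k)" and z: "z \<in> pverts (G n)" and uz: "T k N g u = T n N f z" for u z
  proof -
    have "T n N f (T k n h u) = T N N t (T k N g u)"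
      using transition_comp[OF h f' u] transition_comp[OF g t u] th by simp
    also have "\<dots> = T n N f z"
      using transpose_fixes_vertex[OF tf f' b _ g c, of "T n N f z"] u z uz
      by (metis imageI t_def)
    finally show ?thesis
      using tf f' z transition_mem[OF h u] by (auto simp: torsion_free_def dest: inj_onD)
  qed
  show ?thesis
    using transition_arc[OF h vw] lift x y gv gw arc_verts[OF vw] by simp
qed

end

theorem theorem3p28:
  fixes G :: "nat \<Rightarrow> 'v pair_pre_digraph"
    and T :: "nat \<Rightarrow> nat \<Rightarrow> (nat \<Rightarrow> nat) \<Rightarrow> 'v \<Rightarrow> 'v"
    and d\<^sub>E n :: nat and f :: "nat \<Rightarrow> nat"
  assumes "FI_graph G T"
    and "FI_graph.torsion_free G T"
    and "FI_graph.vertex_stable G T"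
    and "FI_graph.edge_stable_degree_le G T d\<^sub>E"
    and "n \<ge> d\<^sub>E"
    and "f \<in> FI_hom n (n + 1)"
  shows "induced_subgraph (with_proj (hom_image (T n (n + 1) f) (G n))) (with_proj (G (n + 1)))"
proof -
  interpret FI_graph G T by (rule assms(1))
  let ?\<phi> = "T n (n + 1) f"
  interpret H: pair_graph "G (n + 1)" by (rule graph)
  define I where "I = hom_image ?\<phi> (G n)"
  \<comment> \<open>This is the arc condition in \<open>induced_subgraph\<close>; it also yields
    well-formedness of \<open>I\<close>.\<close>
  have I_arcs: "(a, b) \<in> parcs I \<longleftrightarrow>
      (a, b) \<in> parcs (G (n + 1)) \<and> a \<in> pverts I \<and> b \<in> pverts I" (is "?L \<longleftrightarrow> ?R") for a b
  proof
    show "?R" if "?L"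
      using that transition_arc[OF assms(6)] arc_verts by (auto simp: I_def hom_image_def)
    show "?L" if "?R"
      using that transition_reflects_arc[OF assms(2,4,5,6)]
      by (auto simp: I_def hom_image_def intro!: rev_image_eqI)
  qed
  have "wf_digraph (with_proj I)"
    by unfold_locales (auto simp: I_arcs)
  moreover have "pverts I \<subseteq> pverts (G (n + 1))"
    using transition_mem[OF assms(6)] by (auto simp: I_def hom_image_def)
  ultimately show ?thesis
    unfolding induced_subgraph_def subgraph_def compatible_def I_def[symmetric]
    using H.wf_digraph_axioms by (auto simp: I_arcs)
qed

end
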